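(* The minimum number of days in which a knight can survey the $7\times 7$ board is $11$.
   Context: Cells of the $n\times n$ board are $(x,y)$ with $1\le x,y\le n$. A knight moves from $(x,y)$ to $(x',y')$ when $\{|x-x'|,|y-y'|\}=\{1,2\}$. A survey of the board in $m$ days by a piece is a sequence of cells $p_1,\dots,p_m$ such that for each $i<m$ the piece can move from $p_i$ to $p_{i+1}$ in one move, and every cell of the board either equals some $p_i$ or can be reached in one move of the piece from some $p_i$. The starting cell $p_1$ can be chosen freely. *)

theory Defs
  imports Main
begin

(* Integer coordinates, so that the differences in knight_move do not truncate. *)
type_synonym cell = "int \<times> int"

definition board :: "nat \<Rightarrow> cell set" where
  "board n = {1..int n} \<times> {1..int n}"

definition knight_move :: "cell \<Rightarrow> cell \<Rightarrow> bool" where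
  "knight_move p q \<longleftrightarrow> {\<bar>fst p - fst q\<bar>, \<bar>snd p - snd q\<bar>} = {1, 2}"

(* A piece is given by its move relation. The number of days of a survey is the
   number of cells in the sequence, the starting cell included. *)
definition is_survey :: "(cell \<Rightarrow> cell \<Rightarrow> bool) \<Rightarrow> nat \<Rightarrow> cell list \<Rightarrow> bool" where
  "is_survey move n ps \<longleftrightarrow>
     set ps \<subseteq> board n \<and>
     (\<forall>i. Suc i < length ps \<longrightarrow> move (ps ! i) (ps ! Suc i)) \<and>
     (\<forall>c\<in>board n. \<exists>p\<in>set ps. c = p \<or> move p c)"

definition can_survey_in :: "(cell \<Rightarrow> cell \<Rightarrow> bool) \<Rightarrow> nat \<Rightarrow> nat \<Rightarrow> bool" where
  "can_survey_in move n m \<longleftrightarrow> (\<exists>ps. length ps = m \<and> is_survey move n ps)"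

definition is_min_days :: "(cell \<Rightarrow> cell \<Rightarrow> bool) \<Rightarrow> nat \<Rightarrow> nat \<Rightarrow> bool" where
  "is_min_days move n m \<longleftrightarrow>
     can_survey_in move n m \<and> (\<forall>k. can_survey_in move n k \<longrightarrow> m \<le> k)"

end

theory Submission
  imports Defs
begin

text \<open>
  A knight changes colour with every move (colour = parity of the coordinate sum), so a walk of
  \<open>k\<close> cells has at most \<open>(k + 1) div 2\<close> cells of either colour.  In a survey of at least two days
  every cell of the board, visited or not, is adjacent to some cell of the walk: a visited cell is
  adjacent to its predecessor or successor.  Hence a set of cells of one colour whose
  neighbourhoods on the board are pairwise disjoint forces equally many different cells of the
  other colour into the walk.

  The four corners of the \<open>7 \<times> 7\<close> board together with \<open>(2,2)\<close> and \<open>(6,6)\<close> are six cells of even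
  coordinate sum with pairwise disjoint neighbourhoods (lemma \<open>packing_disjoint\<close>): the neighbours
  of distinct corners lie near those corners, and every neighbour of \<open>(2,2)\<close> or \<open>(6,6)\<close> has a
  coordinate \<open>4\<close>, which no neighbour of a corner has, and another coordinate that is below \<open>4\<close>
  for \<open>(2,2)\<close> and above \<open>4\<close> for \<open>(6,6)\<close>.  So a survey contains six cells of odd
  coordinate sum, and therefore has at least eleven cells.  An explicit walk attains this.
\<close>

lemma knight_move_sym: "knight_move p q \<Longrightarrow> knight_move q p"
  by (simp add: knight_move_def abs_minus_commute)

lemma knight_move_iff:
  "knight_move p q \<longleftrightarrow>
     \<bar>fst p - fst q\<bar> = 1 \<and> \<bar>snd p - snd q\<bar> = 2 \<or> \<bar>fst p - fst q\<bar> = 2 \<and> \<bar>snd p - snd q\<bar> = 1"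
  by (auto simp: knight_move_def doubleton_eq_iff)

definition dark :: "cell \<Rightarrow> bool" where
  "dark p \<longleftrightarrow> odd (fst p + snd p)"

lemma knight_move_dark: "knight_move p q \<Longrightarrow> dark p \<longleftrightarrow> \<not> dark q"
proof -
  assume "knight_move p q"
  then have "odd (\<bar>fst p - fst q\<bar> + \<bar>snd p - snd q\<bar>)"
    unfolding knight_move_iff by (elim disjE conjE) simp_all
  then show ?thesis by (simp add: dark_def) blast
qed

lemma is_survey_successively: "is_survey move n ps \<Longrightarrow> successively move ps"
  by (simp add: is_survey_def successively_conv_nth)

text \<open>The walk splits into pairs of consecutive cells, with possibly one cell left over, and each
  pair has a single dark cell.\<close>

lemma card_dark_le:
  assumes "successively knight_move ps"
  shows "2 * card {p \<in> set ps. dark p} \<le> length ps + 1"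
  using assms
proof (induction ps rule: induct_list012)
  case 1
  then show ?case by simp
next
  case (2 x)
  have "card {p \<in> set [x]. dark p} \<le> card {x}" by (rule card_mono) auto
  then show ?case by simp
next
  case (3 x y zs)
  let ?z = "if dark x then x else y"
  from "3.prems" have "dark x \<longleftrightarrow> \<not> dark y"
    by (simp add: knight_move_dark)
  then have "{p \<in> set (x # y # zs). dark p} \<subseteq> insert ?z {p \<in> set zs. dark p}" by auto
  then have "card {p \<in> set (x # y # zs). dark p} \<le> card (insert ?z {p \<in> set zs. dark p})"
    by (rule card_mono[rotated]) simp
  also have "\<dots> \<le> Suc (card {p \<in> set zs. dark p})" by (rule card_insert_le_m1) simp_all
  finally have step: "card {p \<in> set (x # y # zs). dark p} \<le> Suc (card {p \<in> set zs. dark p})" .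
  from "3.prems" have "successively knight_move zs" by (cases zs) auto
  from "3.IH"(1)[OF this] step show ?case by simp
qed

lemma visited_has_visited_neighbour:
  assumes "successively knight_move ps" and "2 \<le> length ps" and "c \<in> set ps"
  shows "\<exists>p\<in>set ps. knight_move p c"
proof -
  from assms(3) obtain i where i: "i < length ps" "c = ps ! i"
    by (auto simp: in_set_conv_nth)
  have moves: "knight_move (ps ! j) (ps ! Suc j)" if "Suc j < length ps" for j
    using assms(1) that by (simp add: successively_conv_nth)
  show ?thesis
  proof (cases i)
    case 0
    with moves[of 0] assms(2) i have "knight_move (ps ! 1) c"
      by (auto intro: knight_move_sym)
    with assms(2) show ?thesis by auto
  next
    case (Suc j)
    with moves[of j] i have "knight_move (ps ! j) c" by simp
    with i Suc show ?thesis by auto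
  qed
qed

text \<open>In a survey of at least two days the domination is total, so disjoint neighbourhoods can be
  counted without an exception for the visited cells.\<close>

lemma survey_dominates_totally:
  assumes "is_survey knight_move n ps" and "2 \<le> length ps" and "c \<in> board n"
  shows "\<exists>p\<in>set ps. knight_move p c"
  using assms visited_has_visited_neighbour[OF is_survey_successively[OF assms(1)] assms(2)]
  unfolding is_survey_def by blast

definition packing :: "cell set" where
  "packing = {(1,1), (1,7), (7,1), (7,7), (2,2), (6,6)}"

lemma card_packing: "card packing = 6"
  by (simp add: packing_def)

lemma packing_subset: "packing \<subseteq> board 7"
  by (auto simp: packing_def board_def)

lemma packing_not_dark: "c \<in> packing \<Longrightarrow> \<not> dark c"
  by (auto simp: packing_def dark_def)

lemma board_7: "board 7 = {1,2,3,4,5,6,7} \<times> {1,2,3,4,5,6,7}"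
  by (simp add: board_def simp_from_to)

text \<open>The board matters here: \<open>(1,1)\<close> and \<open>(2,2)\<close> have the common neighbours \<open>(3,0)\<close> and \<open>(0,3)\<close>
  in the infinite grid.\<close>

lemma packing_disjoint:
  assumes "p \<in> board 7" and "c \<in> packing" "d \<in> packing"
    and "knight_move p c" "knight_move p d"
  shows "c = d"
proof -
  have "\<forall>p\<in>board 7. \<forall>c\<in>packing. knight_move p c \<longrightarrow> (\<forall>d\<in>packing. knight_move p d \<longrightarrow> c = d)"
    by (simp add: board_7 packing_def knight_move_iff)
  with assms show ?thesis by blast
qed

lemma survey_card_dark:
  assumes "is_survey knight_move 7 ps" and "2 \<le> length ps"
  shows "6 \<le> card {p \<in> set ps. dark p}"
proof -
  have "\<forall>c\<in>packing. \<exists>p. p \<in> set ps \<and> knight_move p c"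
    using survey_dominates_totally[OF assms] packing_subset by blast
  then obtain f where f: "\<And>c. c \<in> packing \<Longrightarrow> f c \<in> set ps \<and> knight_move (f c) c"
    by metis
  have "set ps \<subseteq> board 7" using assms(1) by (simp add: is_survey_def)
  with f have "inj_on f packing"
    by (intro inj_onI) (metis packing_disjoint subsetD)
  moreover have "f ` packing \<subseteq> {p \<in> set ps. dark p}"
    using f knight_move_dark packing_not_dark by blast
  ultimately have "card packing \<le> card {p \<in> set ps. dark p}"
    by (intro card_inj_on_le) auto
  then show ?thesis by (simp add: card_packing)
qed

text \<open>A one-day walk has no predecessor or successor to cover its only cell, so total domination
  has to be preceded by this exclusion.\<close>

lemma survey_length_ge_2:
  assumes "is_survey knight_move 7 ps"
  shows "2 \<le> length ps"
proof (rule ccontr)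
  assume "\<not> 2 \<le> length ps"
  then consider "ps = []" | p where "ps = [p]"
    by (cases ps; cases "tl ps") auto
  moreover have "\<exists>p\<in>set ps. c = p \<or> knight_move p c" if "c \<in> packing" for c
    using assms that packing_subset by (auto simp: is_survey_def)
  from this[of "(1,1)"] this[of "(7,7)"]
  have "\<exists>p\<in>set ps. (1,1) = p \<or> knight_move p (1,1)" "\<exists>p\<in>set ps. (7,7) = p \<or> knight_move p (7,7)"
    by (simp_all add: packing_def)
  ultimately show False
    by cases (auto simp: knight_move_iff)
qed

text \<open>Every other cell of the walk, from the first to the last, is dark; these are six cells, as
  few as the packing permits, and they dominate the cells that are not dark.  Between them lie
  \<open>(3,3)\<close>, \<open>(3,5)\<close>, \<open>(5,3)\<close>, \<open>(5,5)\<close>, which attack every dark cell of the board, and \<open>(4,4)\<close>,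
  which links the two halves of the walk.\<close>

definition survey_walk :: "cell list" where
  "survey_walk =
     [(2,3), (3,5), (4,3), (5,5), (6,3), (4,4), (2,5), (3,3), (4,5), (5,3), (6,5)]"

lemma is_survey_survey_walk: "is_survey knight_move 7 survey_walk"
proof -
  have "set survey_walk \<subseteq> board 7"
    by (simp add: survey_walk_def board_7)
  moreover have "successively knight_move survey_walk"
    by (simp add: survey_walk_def knight_move_iff)
  moreover have "\<forall>c\<in>board 7. \<exists>p\<in>set survey_walk. c = p \<or> knight_move p c"
    by (simp add: survey_walk_def board_7 knight_move_iff)
  ultimately show ?thesis
    by (simp add: is_survey_def successively_conv_nth)
qed

theorem mainTheorem2:
  shows "is_min_days knight_move 7 11"
  unfolding is_min_days_def
proof (intro conjI allI impI)
  show "can_survey_in knight_move 7 11"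
    using is_survey_survey_walk unfolding can_survey_in_def
    by (intro exI[of _ survey_walk]) (simp add: survey_walk_def)
next
  fix k
  assume "can_survey_in knight_move 7 k"
  then obtain ps where ps: "length ps = k" "is_survey knight_move 7 ps"
    by (auto simp: can_survey_in_def)
  from survey_card_dark[OF ps(2) survey_length_ge_2[OF ps(2)]]
    card_dark_le[OF is_survey_successively[OF ps(2)]] ps(1)
  show "11 \<le> k" by simp
qed

end
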